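(* Let $K$ and $\alpha$ be formulas of $\mathcal{L}_{\mathcal{P}}$. Then $$Cn(K)\,\dot{+}\,\alpha \;=\; Cn\bigl(\lceil (Cn(K),\{\alpha\},\emptyset)\rceil\wedge\alpha\bigr),$$ and this is logically equivalent to $\lceil (K,\{\alpha\},\emptyset)\rceil\wedge\alpha$, i.e. $Cn(K)\dot{+}\alpha=Cn\bigl(\lceil (K,\{\alpha\},\emptyset)\rceil\wedge\alpha\bigr)$.
   Context: $\mathcal{L}_{\mathcal{P}}$ is the classical propositional language over a set $\mathcal{P}$ of atoms, $\vdash$ is classical consequence, and $Cn(\cdot)$ is deductive closure in $\mathcal{L}_{\mathcal P}$ (or, where primed atoms occur, in $\mathcal{L}_{\mathcal{P}\cup\mathcal{P}'}$). $\mathcal{P}'=\{p'\mid p\in\mathcal{P}\}$ is a disjoint copy of $\mathcal{P}$. For a set of formulas $K$ of $\mathcal{L}_{\mathcal P}$, $K'$ is the result of replacing each atom $p$ by $p'$. A formula $K$ is identified with $\{K\}$ where a set is required. A belief change scenario is a triple $B=(K,U,V)$ of sets of formulas of $\mathcal{L}_{\mathcal{P}}$. Let $(EQ_i)_{i\in I}$ be the family of all sets $EQ\subseteq\{p\equiv p'\mid p\in\mathcal{P}\}$ that are maximal with respect to inclusion such that $K'\cup EQ\cup U\cup V\not\vdash\bot$. The sets $E_i=Cn(K'\cup EQ_i\cup U)\cap\mathcal{L}_{\mathcal{P}}$, $i\in I$, are the consistent definitional extensions of $B$. Revision: for a deductively closed $K$ and a formula $\alpha$, $K\dot{+}\alpha=\bigcap_{i\in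 I}E_i$, where $(E_i)_{i\in I}$ is the family of all consistent definitional extensions of $(K,\{\alpha\},\emptyset)$; the intersection of the empty family is $\mathcal{L}_{\mathcal{P}}$. For a formula $s\in\mathcal{L}_{\mathcal{P}}$ and $i\in I$, $\lceil s\rceil_i$ is the result of replacing in $s$ each atom $p$ with $(p\equiv p')\notin EQ_i$ by $\neg p$. Define $\lceil B\rceil=\bigvee_{i\in I}\bigwedge_{s\in K}\lceil s\rceil_i$. When $K$ is infinite the conjunction is understood semantically (an interpretation satisfies it iff it satisfies all conjuncts), and $Cn$ of the resulting expression is the set of formulas of $\mathcal{L}_{\mathcal{P}}$ true in all interpretations satisfying it; the empty disjunction is $\bot$. *)

theory Defs
  imports Main
begin

datatype 'a form =
    Atom 'a
  | Falsum
  | Verum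
  | Neg "'a form"
  | Conj "'a form" "'a form"
  | Disj "'a form" "'a form"
  | Imp "'a form" "'a form"
  | Iff "'a form" "'a form"

primrec sat :: "('a \<Rightarrow> bool) \<Rightarrow> 'a form \<Rightarrow> bool" where
  "sat v (Atom p) \<longleftrightarrow> v p"
| "sat v Falsum \<longleftrightarrow> False"
| "sat v Verum \<longleftrightarrow> True"
| "sat v (Neg f) \<longleftrightarrow> \<not> sat v f"
| "sat v (Conj f g) \<longleftrightarrow> sat v f \<and> sat v g"
| "sat v (Disj f g) \<longleftrightarrow> sat v f \<or> sat v g"
| "sat v (Imp f g) \<longleftrightarrow> (sat v f \<longrightarrow> sat v g)"
| "sat v (Iff f g) \<longleftrightarrow> (sat v f \<longleftrightarrow> sat v g)"

definition models :: "'a form \<Rightarrow> ('a \<Rightarrow> bool) set" where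
  "models f = {v. sat v f}"

definition entails :: "'a form set \<Rightarrow> 'a form \<Rightarrow> bool" where
  "entails \<Gamma> f \<longleftrightarrow> (\<forall>v. (\<forall>g\<in>\<Gamma>. sat v g) \<longrightarrow> sat v f)"

definition Cn :: "'a form set \<Rightarrow> 'a form set" where
  "Cn \<Gamma> = {f. entails \<Gamma> f}"

primrec subst :: "('a \<Rightarrow> 'b form) \<Rightarrow> 'a form \<Rightarrow> 'b form" where
  "subst \<sigma> (Atom p) = \<sigma> p"
| "subst \<sigma> Falsum = Falsum"
| "subst \<sigma> Verum = Verum"
| "subst \<sigma> (Neg f) = Neg (subst \<sigma> f)"
| "subst \<sigma> (Conj f g) = Conj (subst \<sigma> f) (subst \<sigma> g)"
| "subst \<sigma> (Disj f g) = Disj (subst \<sigma> f) (subst \<sigma> g)"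
| "subst \<sigma> (Imp f g) = Imp (subst \<sigma> f) (subst \<sigma> g)"
| "subst \<sigma> (Iff f g) = Iff (subst \<sigma> f) (subst \<sigma> g)"

text \<open>
  The set P of atoms is the type \<open>'p\<close>; its disjoint union with the copy P' is \<open>'p atom\<close>.
  The inclusion of the language over P into the language over P and P' is the map \<open>unprimed\<close>.
\<close>

datatype 'p atom = Plain 'p | Primed 'p

abbreviation unprimed :: "'p form \<Rightarrow> 'p atom form" where
  "unprimed \<equiv> map_form Plain"

abbreviation primed :: "'p form \<Rightarrow> 'p atom form" where
  "primed \<equiv> map_form Primed"

definition eq_atom :: "'p \<Rightarrow> 'p atom form" where
  "eq_atom p = Iff (Atom (Plain p)) (Atom (Primed p))"

type_synonym 'p scenario = "'p form set \<times> 'p form set \<times> 'p form set"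

definition admissible_EQ :: "'p scenario \<Rightarrow> 'p atom form set \<Rightarrow> bool" where
  "admissible_EQ B EQ \<longleftrightarrow> (case B of (K, U, V) \<Rightarrow>
     EQ \<subseteq> range eq_atom \<and>
     \<not> entails (primed ` K \<union> EQ \<union> unprimed ` U \<union> unprimed ` V) Falsum)"

text \<open>The family of all maximal sets EQ is indexed by itself, i.e. represented by its range.\<close>

definition maximal_EQs :: "'p scenario \<Rightarrow> 'p atom form set set" where
  "maximal_EQs B = {EQ. admissible_EQ B EQ \<and>
     (\<forall>EQ'. admissible_EQ B EQ' \<and> EQ \<subseteq> EQ' \<longrightarrow> EQ' = EQ)}"

text \<open>Intersecting with the language over P is taking the preimage under \<open>unprimed\<close>.\<close>

definition extension :: "'p scenario \<Rightarrow> 'p atom form set \<Rightarrow> 'p form set" where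
  "extension B EQ = (case B of (K, U, V) \<Rightarrow>
     unprimed -` Cn (primed ` K \<union> EQ \<union> unprimed ` U))"

definition consistent_extensions :: "'p scenario \<Rightarrow> 'p form set set" where
  "consistent_extensions B = extension B ` maximal_EQs B"

definition revise :: "'p form set \<Rightarrow> 'p form \<Rightarrow> 'p form set" where
  "revise K \<alpha> = \<Inter> (consistent_extensions (K, {\<alpha>}, {}))"

definition flip :: "'p atom form set \<Rightarrow> 'p form \<Rightarrow> 'p form" where
  "flip EQ = subst (\<lambda>p. if eq_atom p \<in> EQ then Atom p else Neg (Atom p))"

text \<open>
  Possibly infinite disjunctions and conjunctions are represented by their sets of satisfying
  interpretations, so that they become unions and intersections; the empty disjunction is the
  empty set and the empty conjunction the set of all interpretations. \<open>Cn_sem\<close> is the set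
  of consequences of an expression represented in this way.
\<close>

definition ceil_models :: "'p scenario \<Rightarrow> ('p \<Rightarrow> bool) set" where
  "ceil_models B = (case B of (K, U, V) \<Rightarrow>
     \<Union>EQ\<in>maximal_EQs B. \<Inter>s\<in>K. models (flip EQ s))"

definition Cn_sem :: "('p \<Rightarrow> bool) set \<Rightarrow> 'p form set" where
  "Cn_sem M = {f. \<forall>v\<in>M. sat v f}"

end

(* A model of K' together with EQ and U is a pair of interpretations: w of the primed atoms with w a
   model of K, and u of the plain atoms with u a model of U, agreeing on the atoms of EQ. Maximality
   of EQ forces u and w to differ at every other atom, so w is determined by u, and "w satisfies s"
   becomes "u satisfies the flipped s". No compactness is needed. *)

theory Submission
  imports Defs
begin

lemma sat_map_form: "sat v (map_form g f) \<longleftrightarrow> sat (v \<circ> g) f"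
  by (induction f) auto

lemma sat_eq_atom: "sat v (eq_atom p) \<longleftrightarrow> (v (Plain p) \<longleftrightarrow> v (Primed p))"
  by (simp add: eq_atom_def)

text \<open>Negating an atom in the formula has the same effect as negating its value. The
  biconditional with \<open>eq_atom p \<in> EQ\<close> covers both cases: it keeps
  \<open>v p\<close> inside \<open>EQ\<close> and negates it outside.\<close>

lemma sat_flip: "sat v (flip EQ s) \<longleftrightarrow> sat (\<lambda>p. v p \<longleftrightarrow> eq_atom p \<in> EQ) s"
  by (induction s) (auto simp: flip_def)

lemma ball_Cn_sat: "(\<forall>s\<in>Cn K. sat v s) \<longleftrightarrow> (\<forall>s\<in>K. sat v s)"
  unfolding Cn_def entails_def by blast

lemma admissible_EQ_iff:
  "admissible_EQ (K, U, V) EQ \<longleftrightarrow> EQ \<subseteq> range eq_atom \<and>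
     (\<exists>v. (\<forall>s\<in>K. sat (v \<circ> Primed) s) \<and> (\<forall>e\<in>EQ. sat v e) \<and>
          (\<forall>s\<in>U \<union> V. sat (v \<circ> Plain) s))"
  by (simp add: admissible_EQ_def entails_def sat_map_form ball_Un conj_ac)

text \<open>Admissibility sees \<open>K\<close> only through its models, and \<open>Cn K\<close> has
  the same ones.\<close>

lemma maximal_EQs_Cn: "maximal_EQs (Cn K, U, V) = maximal_EQs (K, U, V)"
  by (simp add: maximal_EQs_def admissible_EQ_iff ball_Cn_sat)

lemma ceil_models_Cn: "ceil_models (Cn K, U, V) = ceil_models (K, U, V)"
proof -
  have "(\<Inter>s\<in>Cn K. models (flip EQ s)) = (\<Inter>s\<in>K. models (flip EQ s))" for EQ :: "'a atom form set"
    unfolding models_def sat_flip using ball_Cn_sat by blast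
  then show ?thesis
    by (simp add: ceil_models_def maximal_EQs_Cn)
qed

text \<open>If \<open>v\<close> made \<open>eq_atom p\<close> true for some \<open>eq_atom p\<close>
  outside \<open>EQ\<close>, then \<open>v\<close> itself would witness that \<open>EQ\<close> can
  be enlarged. With the third component empty, the conditions on \<open>v\<close> are all that
  admissibility asks.\<close>

lemma maximal_EQs_sat_iff:
  assumes EQ: "EQ \<in> maximal_EQs (K, U, {})"
    and K: "\<forall>s\<in>K. sat (v \<circ> Primed) s"
    and e: "\<forall>e\<in>EQ. sat v e"
    and U: "\<forall>s\<in>U. sat (v \<circ> Plain) s"
  shows "v (Primed p) \<longleftrightarrow> (v (Plain p) \<longleftrightarrow> eq_atom p \<in> EQ)"
proof (cases "eq_atom p \<in> EQ")
  case True
  with e have "sat v (eq_atom p)" ..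
  then show ?thesis by (simp add: sat_eq_atom True)
next
  case False
  have "\<not> sat v (eq_atom p)"
  proof
    assume "sat v (eq_atom p)"
    moreover have "EQ \<subseteq> range eq_atom"
      using EQ by (simp add: maximal_EQs_def admissible_EQ_iff)
    ultimately have "admissible_EQ (K, U, {}) (insert (eq_atom p) EQ)"
      unfolding admissible_EQ_iff using K e U by blast
    then show False
      using EQ False unfolding maximal_EQs_def by blast
  qed
  with False show ?thesis by (simp add: sat_eq_atom)
qed

lemma extension_eq_Cn_sem:
  assumes EQ: "EQ \<in> maximal_EQs (K, U, {})"
  shows "extension (K, U, {}) EQ =
    Cn_sem ((\<Inter>s\<in>K. models (flip EQ s)) \<inter> (\<Inter>s\<in>U. models s))"
proof -
  \<comment> \<open>The values that \<open>u\<close> forces on the primed atoms.\<close>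
  let ?flip = "\<lambda>u p. u p \<longleftrightarrow> eq_atom p \<in> EQ"
  let ?model = "\<lambda>v. (\<forall>s\<in>K. sat (v \<circ> Primed) s) \<and> (\<forall>e\<in>EQ. sat v e) \<and> (\<forall>s\<in>U. sat (v \<circ> Plain) s)"
  have model_flip: "\<exists>v. ?model v \<and> v \<circ> Plain = u"
    if "\<forall>s\<in>K. sat (?flip u) s" "\<forall>s\<in>U. sat u s" for u
  proof (intro exI conjI)
    \<comment> \<open>Glue \<open>u\<close> on the plain atoms to its flip on the primed ones; the
      two agree at each \<open>p\<close> with \<open>eq_atom p\<close> in \<open>EQ\<close>.\<close>
    let ?v = "case_atom u (?flip u)"
    have [simp]: "?v \<circ> Plain = u" "?v \<circ> Primed = ?flip u"
      by auto
    show "\<forall>s\<in>K. sat (?v \<circ> Primed) s" "\<forall>s\<in>U. sat (?v \<circ> Plain) s" "?v \<circ> Plain = u"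
      using that by simp_all
    have "EQ \<subseteq> range eq_atom"
      using EQ by (simp add: maximal_EQs_def admissible_EQ_iff)
    then show "\<forall>e\<in>EQ. sat ?v e"
      by (auto simp: sat_eq_atom)
  qed
  have flip_model: "\<forall>s\<in>K. sat (?flip (v \<circ> Plain)) s" if "?model v" for v
  proof -
    \<comment> \<open>Maximality enters here: the primed half of a model has no freedom
      left.\<close>
    have "v \<circ> Primed = ?flip (v \<circ> Plain)"
      using maximal_EQs_sat_iff[OF EQ] that by auto
    then show ?thesis using that by simp
  qed
  have "f \<in> extension (K, U, {}) EQ \<longleftrightarrow> (\<forall>v. ?model v \<longrightarrow> sat (v \<circ> Plain) f)" for f
    by (simp add: extension_def Cn_def entails_def sat_map_form ball_Un conj_ac)
  moreover have "f \<in> Cn_sem ((\<Inter>s\<in>K. models (flip EQ s)) \<inter> (\<Inter>s\<in>U. models s)) \<longleftrightarrow>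
      (\<forall>u. (\<forall>s\<in>K. sat (?flip u) s) \<and> (\<forall>s\<in>U. sat u s) \<longrightarrow> sat u f)" for f
    unfolding Cn_sem_def models_def sat_flip by blast
  moreover have "(\<forall>v. ?model v \<longrightarrow> sat (v \<circ> Plain) f) \<longleftrightarrow>
      (\<forall>u. (\<forall>s\<in>K. sat (?flip u) s) \<and> (\<forall>s\<in>U. sat u s) \<longrightarrow> sat u f)" for f
  proof (intro iffI allI impI)
    fix u
    assume "\<forall>v. ?model v \<longrightarrow> sat (v \<circ> Plain) f"
      and "(\<forall>s\<in>K. sat (?flip u) s) \<and> (\<forall>s\<in>U. sat u s)"
    then show "sat u f" using model_flip[of u] by blast
  next
    fix v
    assume "\<forall>u. (\<forall>s\<in>K. sat (?flip u) s) \<and> (\<forall>s\<in>U. sat u s) \<longrightarrow> sat u f" and "?model v"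
    then show "sat (v \<circ> Plain) f" using flip_model[of v] by blast
  qed
  ultimately show ?thesis by (intro set_eqI) simp
qed

lemma revise_eq_Cn_sem:
  "revise K \<alpha> = Cn_sem (ceil_models (K, {\<alpha>}, {}) \<inter> models \<alpha>)"
proof -
  have "revise K \<alpha> = (\<Inter>EQ\<in>maximal_EQs (K, {\<alpha>}, {}).
      Cn_sem ((\<Inter>s\<in>K. models (flip EQ s)) \<inter> models \<alpha>))"
    by (simp add: revise_def consistent_extensions_def extension_eq_Cn_sem)
  \<comment> \<open>Intersecting theories corresponds to uniting their classes of models. If there
    is no maximal \<open>EQ\<close>, both sides are the whole language.\<close>
  also have "\<dots> = Cn_sem (ceil_models (K, {\<alpha>}, {}) \<inter> models \<alpha>)"
    by (auto simp: Cn_sem_def ceil_models_def)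
  finally show ?thesis .
qed

theorem theorem9:
  fixes K \<alpha> :: "'p form"
  shows "revise (Cn {K}) \<alpha> = Cn_sem (ceil_models (Cn {K}, {\<alpha>}, {}) \<inter> models \<alpha>) \<and>
         revise (Cn {K}) \<alpha> = Cn_sem (ceil_models ({K}, {\<alpha>}, {}) \<inter> models \<alpha>)"
  by (simp add: revise_eq_Cn_sem ceil_models_Cn)

end
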